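(* Assume $-F'(\bar u)\in\partial G_1(\bar u)$. Then $$G_1''(\bar u,-F'(\bar u);v)=0\qquad\forall v\in C_{\bar u},$$ and $G_1$ is strongly twice epi-differentiable at $\bar u$ for $-F'(\bar u)$.
   Context: Setting: $\Omega\subset\mathbb R^d$ is non-empty, open and bounded, $T>0$, $\Omega_T:=\Omega\times(0,T)$; $\alpha<\beta$ are real constants, $\mu>0$; $U_{\mathrm{ad}}:=\{u\in L^2(\Omega_T):\alpha\le u\le\beta\text{ a.e.}\}$, with indicator function $\delta_{U_{\mathrm{ad}}}\colon L^2(\Omega_T)\to\{0,\infty\}$; $\bar u\in U_{\mathrm{ad}}$ is fixed. $j_1(u):=\int_{\Omega_T}|u|\,\mathrm d(x,t)$ and $G_1:=\delta_{U_{\mathrm{ad}}}+\mu j_1$, a convex function on $L^2(\Omega_T)$ with convex subdifferential $\partial G_1$. $F\colon U_{\mathrm{ad}}\to\mathbb R$ is such that there are $F'(\bar u)\in L^2(\Omega_T)$ and a bounded bilinear form $F''(\bar u)$ on $L^2(\Omega_T)$ with $\lim_{k\to\infty}t_k^{-2}\big(F(\bar u+t_kv_k)-F(\bar u)-t_kF'(\bar u)v_k-\frac12t_k^2F''(\bar u)v_k^2\big)=0$ for all $t_k\searrow0$ ($t_k>0$), $v_k\rightharpoonup v$ in $L^2(\Omega_T)$ with $\bar u+t_kv_k\in U_{\mathrm{ad}}$. Here $F'(\bar u)v=\int_{\Omega_T}F'(\bar u)v$. Tangent cone: $\mathcal T_{U_{\mathrm{ad}}}(\bar u)=\{v\in L^2(\Omega_T):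 v\ge0\text{ a.e. where }\bar u=\alpha,\ v\le0\text{ a.e. where }\bar u=\beta\}$. Critical cone: $C_{\bar u}:=\{v\in\mathcal T_{U_{\mathrm{ad}}}(\bar u):F'(\bar u)v+\mu j_1'(\bar u;v)=0\}$, where $j_1'(\bar u;v)$ is the directional derivative. Weak second subderivative: for $w,v\in L^2(\Omega_T)$, $$G_1''(\bar u,w;v):=\inf\Big\{\liminf_{k\to\infty}\frac{G_1(\bar u+t_kv_k)-G_1(\bar u)-t_k\langle w,v_k\rangle}{t_k^2/2}: t_k\searrow0,\ v_k\rightharpoonup v\text{ in }L^2(\Omega_T)\Big\}.$$ $G_1$ is strongly twice epi-differentiable at $\bar u$ for $w$ if for every $v\in L^2(\Omega_T)$ and every $(t_k)\subset(0,\infty)$ with $t_k\searrow0$ there is $v_k\to v$ (strongly in $L^2(\Omega_T)$) such that the quotients $\frac{G_1(\bar u+t_kv_k)-G_1(\bar u)-t_k\langle w,v_k\rangle}{t_k^2/2}$ converge to $G_1''(\bar u,w;v)$. *)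

theory Defs
  imports "HOL-Analysis.Analysis"
begin

(* Elements of L^2(M) are represented by functions, not by equivalence classes; two functions
   that agree almost everywhere stand for the same element.  All notions below are invariant
   under changing representatives. *)

definition L2 :: "'a measure \<Rightarrow> ('a \<Rightarrow> real) set" where
  "L2 M = {f \<in> borel_measurable M. integrable M (\<lambda>x. (f x)\<^sup>2)}"

definition L2_inner :: "'a measure \<Rightarrow> ('a \<Rightarrow> real) \<Rightarrow> ('a \<Rightarrow> real) \<Rightarrow> real" where
  "L2_inner M f g = (\<integral>x. f x * g x \<partial>M)"

definition L2_norm :: "'a measure \<Rightarrow> ('a \<Rightarrow> real) \<Rightarrow> real" where
  "L2_norm M f = sqrt (L2_inner M f f)"

definition L2_strong_conv ::
    "'a measure \<Rightarrow> (nat \<Rightarrow> 'a \<Rightarrow> real) \<Rightarrow> ('a \<Rightarrow> real) \<Rightarrow> bool" where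
  "L2_strong_conv M V v \<longleftrightarrow> v \<in> L2 M \<and> (\<forall>k. V k \<in> L2 M) \<and>
     (\<lambda>k. L2_norm M (\<lambda>x. V k x - v x)) \<longlonglongrightarrow> 0"

definition L2_weak_conv ::
    "'a measure \<Rightarrow> (nat \<Rightarrow> 'a \<Rightarrow> real) \<Rightarrow> ('a \<Rightarrow> real) \<Rightarrow> bool" where
  "L2_weak_conv M V v \<longleftrightarrow> v \<in> L2 M \<and> (\<forall>k. V k \<in> L2 M) \<and>
     (\<forall>\<phi>\<in>L2 M. (\<lambda>k. L2_inner M \<phi> (V k)) \<longlonglongrightarrow> L2_inner M \<phi> v)"

(* The library's bounded_bilinear needs normed vector spaces given as types.  Boundedness
   makes such a form independent of the choice of representatives. *)
definition bounded_bilinear_form_L2 ::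
    "'a measure \<Rightarrow> (('a \<Rightarrow> real) \<Rightarrow> ('a \<Rightarrow> real) \<Rightarrow> real) \<Rightarrow> bool" where
  "bounded_bilinear_form_L2 M B \<longleftrightarrow>
     (\<forall>u\<in>L2 M. \<forall>v\<in>L2 M. \<forall>w\<in>L2 M. \<forall>a b.
        B (\<lambda>x. a * u x + b * v x) w = a * B u w + b * B v w \<and>
        B w (\<lambda>x. a * u x + b * v x) = a * B w u + b * B w v) \<and>
     (\<exists>C. \<forall>u\<in>L2 M. \<forall>v\<in>L2 M. \<bar>B u v\<bar> \<le> C * L2_norm M u * L2_norm M v)"

(* Convergence to 0 from above; the sequence need not be monotone. *)
definition decr_to_zero :: "(nat \<Rightarrow> real) \<Rightarrow> bool" where
  "decr_to_zero t \<longleftrightarrow> (\<forall>k. 0 < t k) \<and> t \<longlonglongrightarrow> 0"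

definition L2_subdifferential ::
    "'a measure \<Rightarrow> (('a \<Rightarrow> real) \<Rightarrow> ereal) \<Rightarrow> ('a \<Rightarrow> real) \<Rightarrow> ('a \<Rightarrow> real) set" where
  "L2_subdifferential M G u = {w \<in> L2 M. \<bar>G u\<bar> \<noteq> \<infinity> \<and>
     (\<forall>v\<in>L2 M. G u + ereal (L2_inner M w (\<lambda>x. v x - u x)) \<le> G v)}"

definition second_quotient ::
    "'a measure \<Rightarrow> (('a \<Rightarrow> real) \<Rightarrow> ereal) \<Rightarrow> ('a \<Rightarrow> real) \<Rightarrow> ('a \<Rightarrow> real) \<Rightarrow>
     real \<Rightarrow> ('a \<Rightarrow> real) \<Rightarrow> ereal" where
  "second_quotient M G u w s v =
     (G (\<lambda>x. u x + s * v x) - G u - ereal (s * L2_inner M w v)) / ereal (s\<^sup>2 / 2)"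

definition weak_second_subderivative ::
    "'a measure \<Rightarrow> (('a \<Rightarrow> real) \<Rightarrow> ereal) \<Rightarrow> ('a \<Rightarrow> real) \<Rightarrow> ('a \<Rightarrow> real) \<Rightarrow>
     ('a \<Rightarrow> real) \<Rightarrow> ereal" where
  "weak_second_subderivative M G u w v =
     Inf {liminf (\<lambda>k. second_quotient M G u w (t k) (V k)) | t V.
            decr_to_zero t \<and> L2_weak_conv M V v}"

definition strongly_twice_epi_differentiable ::
    "'a measure \<Rightarrow> (('a \<Rightarrow> real) \<Rightarrow> ereal) \<Rightarrow> ('a \<Rightarrow> real) \<Rightarrow> ('a \<Rightarrow> real) \<Rightarrow> bool" where
  "strongly_twice_epi_differentiable M G u w \<longleftrightarrow>
     (\<forall>v\<in>L2 M. \<forall>t. decr_to_zero t \<longrightarrow>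
        (\<exists>V. L2_strong_conv M V v \<and>
             (\<lambda>k. second_quotient M G u w (t k) (V k))
                \<longlonglongrightarrow> weak_second_subderivative M G u w v))"

definition U_ad :: "'a measure \<Rightarrow> real \<Rightarrow> real \<Rightarrow> ('a \<Rightarrow> real) set" where
  "U_ad M \<alpha> \<beta> = {u \<in> L2 M. AE x in M. \<alpha> \<le> u x \<and> u x \<le> \<beta>}"

definition indicator_fun :: "'b set \<Rightarrow> 'b \<Rightarrow> ereal" where
  "indicator_fun C u = (if u \<in> C then 0 else \<infinity>)"

definition j1 :: "'a measure \<Rightarrow> ('a \<Rightarrow> real) \<Rightarrow> real" where
  "j1 M u = (\<integral>x. \<bar>u x\<bar> \<partial>M)"

definition G1 :: "'a measure \<Rightarrow> real \<Rightarrow> real \<Rightarrow> real \<Rightarrow> ('a \<Rightarrow> real) \<Rightarrow> ereal" where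
  "G1 M \<alpha> \<beta> \<mu> u = indicator_fun (U_ad M \<alpha> \<beta>) u + ereal (\<mu> * j1 M u)"

(* For j1 on L2 of a finite measure the limit always exists, as j1 is convex and Lipschitz. *)
definition dir_deriv ::
    "(('a \<Rightarrow> real) \<Rightarrow> real) \<Rightarrow> ('a \<Rightarrow> real) \<Rightarrow> ('a \<Rightarrow> real) \<Rightarrow> real" where
  "dir_deriv J u v = Lim (at_right 0) (\<lambda>s. (J (\<lambda>x. u x + s * v x) - J u) / s)"

definition tangent_cone ::
    "'a measure \<Rightarrow> real \<Rightarrow> real \<Rightarrow> ('a \<Rightarrow> real) \<Rightarrow> ('a \<Rightarrow> real) set" where
  "tangent_cone M \<alpha> \<beta> u =
     {v \<in> L2 M. AE x in M. (u x = \<alpha> \<longrightarrow> 0 \<le> v x) \<and> (u x = \<beta> \<longrightarrow> v x \<le> 0)}"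

(* The argument dF is the L^2 representative of the derivative of F at u. *)
definition critical_cone ::
    "'a measure \<Rightarrow> real \<Rightarrow> real \<Rightarrow> real \<Rightarrow> ('a \<Rightarrow> real) \<Rightarrow> ('a \<Rightarrow> real) \<Rightarrow> ('a \<Rightarrow> real) set" where
  "critical_cone M \<alpha> \<beta> \<mu> dF u =
     {v \<in> tangent_cone M \<alpha> \<beta> u. L2_inner M dF v + \<mu> * dir_deriv (j1 M) u v = 0}"

abbreviation cylinder :: "('b::euclidean_space) set \<Rightarrow> real \<Rightarrow> ('b \<times> real) measure" where
  "cylinder \<Omega> T \<equiv> lebesgue_on (\<Omega> \<times> {0<..<T})"

end

theory Submission
  imports Defs
begin

text \<open>
  Where \<open>abs\<close> is affine along the step from \<open>ubar\<close> in direction \<open>v\<close> and the step stays in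
  \<open>[\<alpha>, \<beta>]\<close>, the increment of \<open>G\<^sub>1\<close> is exactly linear in the step size.  For a tangent direction
  \<open>v\<close> this happens at almost every point once the step is small enough.  Truncating \<open>v\<close> to zero
  elsewhere and testing the subgradient inequality with these truncations shows
  \<open>\<mu> abs'(ubar; v) - w v \<ge> 0\<close> almost everywhere.  On the critical cone the integral of this
  function vanishes, hence so does the function, and the truncations of \<open>v\<close> converge strongly to
  \<open>v\<close> with all second-order quotients equal to zero.  Off the critical cone the quotients tend to
  infinity along every weakly convergent sequence: either the points are eventually infeasible, or
  the first-order term is bounded below by a positive multiple of the step size.
\<close>

section \<open>Square-integrable functions\<close>

lemma L2_measurable: "f \<in> L2 M \<Longrightarrow> f \<in> borel_measurable M"
  by (simp add: L2_def)

lemma L2_square_integrable: "f \<in> L2 M \<Longrightarrow> integrable M (\<lambda>x. (f x)\<^sup>2)"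
  by (simp add: L2_def)

lemma L2_dominated:
  assumes "g \<in> L2 M" "f \<in> borel_measurable M" "\<And>x. \<bar>f x\<bar> \<le> \<bar>g x\<bar>"
  shows "f \<in> L2 M"
proof -
  have "integrable M (\<lambda>x. (f x)\<^sup>2)"
    by (rule Bochner_Integration.integrable_bound[OF L2_square_integrable[OF assms(1)]])
       (use assms in \<open>auto simp: abs_le_square_iff\<close>)
  with assms(2) show ?thesis by (simp add: L2_def)
qed

lemma L2_mult_integrable:
  assumes "f \<in> L2 M" "g \<in> L2 M"
  shows "integrable M (\<lambda>x. f x * g x)"
proof (rule Bochner_Integration.integrable_bound)
  show "integrable M (\<lambda>x. (f x)\<^sup>2 + (g x)\<^sup>2)"
    using assms by (intro Bochner_Integration.integrable_add L2_square_integrable)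
  show "(\<lambda>x. f x * g x) \<in> borel_measurable M"
    using assms by (intro borel_measurable_times L2_measurable)
  have "\<bar>a * b\<bar> \<le> a\<^sup>2 + b\<^sup>2" for a b :: real
    using sum_squares_bound[of "\<bar>a\<bar>" "\<bar>b\<bar>"] mult_nonneg_nonneg[of "\<bar>a\<bar>" "\<bar>b\<bar>"]
    unfolding abs_mult power2_abs by linarith
  then show "AE x in M. norm (f x * g x) \<le> norm ((f x)\<^sup>2 + (g x)\<^sup>2)"
    by simp
qed

lemma L2_cmult: "f \<in> L2 M \<Longrightarrow> (\<lambda>x. c * f x) \<in> L2 M"
  by (auto simp: L2_def power_mult_distrib intro!: borel_measurable_times)

lemma L2_add:
  assumes "f \<in> L2 M" "g \<in> L2 M"
  shows "(\<lambda>x. f x + g x) \<in> L2 M"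
proof -
  have "integrable M (\<lambda>x. (f x)\<^sup>2 + (g x)\<^sup>2 + 2 * (f x * g x))"
    using assms
    by (intro Bochner_Integration.integrable_add integrable_mult_right L2_mult_integrable
          L2_square_integrable)
  moreover have "(\<lambda>x. (f x + g x)\<^sup>2) = (\<lambda>x. (f x)\<^sup>2 + (g x)\<^sup>2 + 2 * (f x * g x))"
    by (auto simp: power2_sum)
  ultimately show ?thesis
    using assms by (auto simp: L2_def intro!: borel_measurable_add)
qed

lemma (in finite_measure) L2_bounded:
  assumes "f \<in> borel_measurable M" "\<And>x. \<bar>f x\<bar> \<le> c"
  shows "f \<in> L2 M"
proof (rule L2_dominated)
  show "(\<lambda>x. c) \<in> L2 M" by (simp add: L2_def)
  show "\<bar>f x\<bar> \<le> \<bar>c\<bar>" for x using assms(2)[of x] by linarith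
qed (fact assms(1))

lemma (in finite_measure) L2_integrable: "f \<in> L2 M \<Longrightarrow> integrable M f"
  using L2_mult_integrable[of f M "\<lambda>x. 1"] L2_bounded[of "\<lambda>x. 1" 1] by simp

section \<open>Strong and weak convergence of square-integrable functions\<close>

lemma L2_strong_conv_const: "v \<in> L2 M \<Longrightarrow> L2_strong_conv M (\<lambda>k. v) v"
  by (simp add: L2_strong_conv_def L2_norm_def L2_inner_def)

text \<open>Weighted Young inequality, integrated. It stands in for Cauchy-Schwarz: the weight
  \<open>c\<close> is free and can be adapted to the size of \<open>g\<close>.\<close>

lemma L2_inner_le:
  assumes "f \<in> L2 M" "g \<in> L2 M" "c > 0"
  shows "\<bar>L2_inner M f g\<bar> \<le> c * L2_inner M f f + L2_inner M g g / c"
proof -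
  have "\<bar>L2_inner M f g\<bar> \<le> (\<integral>x. \<bar>f x * g x\<bar> \<partial>M)"
    unfolding L2_inner_def by (rule integral_abs_bound)
  also have "\<dots> \<le> (\<integral>x. c * (f x * f x) + g x * g x / c \<partial>M)"
  proof (rule integral_mono)
    fix x
    have "2 * (c * \<bar>f x * g x\<bar>) \<le> (c * f x)\<^sup>2 + (g x)\<^sup>2"
      using sum_squares_bound[of "c * \<bar>f x\<bar>" "\<bar>g x\<bar>"]
      by (simp add: abs_mult power_mult_distrib mult.assoc)
    moreover have "0 \<le> c * \<bar>f x * g x\<bar>" using assms(3) by simp
    ultimately have "c * \<bar>f x * g x\<bar> \<le> (c * f x)\<^sup>2 + (g x)\<^sup>2" by linarith
    then have "c * \<bar>f x * g x\<bar> \<le> c * (c * (f x * f x) + g x * g x / c)"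
      using assms(3) by (simp add: power2_eq_square algebra_simps)
    with assms(3) show "\<bar>f x * g x\<bar> \<le> c * (f x * f x) + g x * g x / c"
      by (simp add: mult_le_cancel_left_pos)
  next
    show "integrable M (\<lambda>x. \<bar>f x * g x\<bar>)"
      using L2_mult_integrable[OF assms(1,2)] by (rule integrable_abs)
    show "integrable M (\<lambda>x. c * (f x * f x) + g x * g x / c)"
      using L2_mult_integrable[OF assms(1,1)] L2_mult_integrable[OF assms(2,2)]
      by (intro Bochner_Integration.integrable_add integrable_mult_right integrable_divide)
  qed
  also have "\<dots> = c * L2_inner M f f + L2_inner M g g / c"
    using L2_mult_integrable[OF assms(1,1)] L2_mult_integrable[OF assms(2,2)]
    by (simp add: L2_inner_def)
  finally show ?thesis .
qed

text \<open>Recovery sequences converge strongly, whereas the infimum in the weak second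
  subderivative runs over weakly convergent sequences; this makes the former competitors in the
  latter.\<close>

lemma L2_strong_imp_weak:
  assumes "L2_strong_conv M V v"
  shows "L2_weak_conv M V v"
proof -
  have v: "v \<in> L2 M" and V: "\<And>k. V k \<in> L2 M"
    and conv: "(\<lambda>k. L2_norm M (\<lambda>x. V k x - v x)) \<longlonglongrightarrow> 0"
    using assms by (auto simp: L2_strong_conv_def)
  have diff: "(\<lambda>x. V k x - v x) \<in> L2 M" for k
    using L2_add[OF V L2_cmult[OF v, of "-1"]] by simp
  have "(\<lambda>k. L2_inner M \<phi> (V k)) \<longlonglongrightarrow> L2_inner M \<phi> v" if \<phi>: "\<phi> \<in> L2 M" for \<phi>
  proof -
    define N where "N k = L2_norm M (\<lambda>x. V k x - v x)" for k
    \<comment> \<open>The weight must be positive, at least \<open>N k\<close>, and tend to 0. The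
      summand \<open>1 / Suc k\<close> secures positivity when \<open>N k = 0\<close>;
      \<open>N k \<le> c k\<close> yields \<open>(N k)\<^sup>2 / c k \<le> N k\<close>.\<close>
    define c where "c k = N k + 1 / Suc k" for k
    have N: "N \<longlonglongrightarrow> 0" using conv by (simp add: N_def[abs_def])
    have sq: "L2_inner M (\<lambda>x. V k x - v x) (\<lambda>x. V k x - v x) = (N k)\<^sup>2" and N0: "0 \<le> N k" for k
      by (simp_all add: N_def L2_norm_def L2_inner_def)
    have c_pos: "c k > 0" and "N k \<le> c k" for k
      using N0[of k] by (auto simp: c_def intro: add_nonneg_pos)
    have bound: "\<bar>L2_inner M \<phi> (V k) - L2_inner M \<phi> v\<bar> \<le> c k * L2_inner M \<phi> \<phi> + N k" for k
    proof -
      have "L2_inner M \<phi> (V k) - L2_inner M \<phi> v = L2_inner M \<phi> (\<lambda>x. V k x - v x)"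
        using L2_mult_integrable[OF \<phi> V] L2_mult_integrable[OF \<phi> v]
        by (simp add: L2_inner_def right_diff_distrib)
      with L2_inner_le[OF \<phi> diff c_pos, of k k]
      have "\<bar>L2_inner M \<phi> (V k) - L2_inner M \<phi> v\<bar> \<le> c k * L2_inner M \<phi> \<phi> + (N k)\<^sup>2 / c k"
        by (simp add: sq)
      moreover have "(N k)\<^sup>2 / c k \<le> N k"
        using c_pos[of k] mult_left_mono[OF \<open>N k \<le> c k\<close> N0[of k]]
        by (simp add: divide_le_eq power2_eq_square)
      ultimately show ?thesis by linarith
    qed
    have "c \<longlonglongrightarrow> 0 + 0"
      unfolding c_def[abs_def] by (intro tendsto_add N LIMSEQ_Suc lim_inverse_n')
    then have "(\<lambda>k. c k * L2_inner M \<phi> \<phi> + N k) \<longlonglongrightarrow> 0 * L2_inner M \<phi> \<phi> + 0"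
      by (intro tendsto_add tendsto_mult tendsto_const N) simp
    then have lim: "(\<lambda>k. c k * L2_inner M \<phi> \<phi> + N k) \<longlonglongrightarrow> 0" by simp
    have "\<forall>k. norm (L2_inner M \<phi> (V k) - L2_inner M \<phi> v) \<le> c k * L2_inner M \<phi> \<phi> + N k"
      by (intro allI) (simp only: real_norm_def bound)
    then have "(\<lambda>k. L2_inner M \<phi> (V k) - L2_inner M \<phi> v) \<longlonglongrightarrow> 0"
      by (rule Lim_null_comparison[OF always_eventually lim])
    then show ?thesis by (rule LIM_zero_cancel)
  qed
  with v V show ?thesis unfolding L2_weak_conv_def by blast
qed

section \<open>The directional derivative of the absolute value\<close>

text \<open>The directional derivative of \<open>abs\<close> at \<open>a\<close> in direction
  \<open>b\<close> is \<open>abs_slope a b * b\<close>. Splitting off the factor \<open>b\<close>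
  leaves a bounded number that can be paired with other directions too.\<close>

definition abs_slope :: "real \<Rightarrow> real \<Rightarrow> real" where
  "abs_slope a b = (if a = 0 then sgn b else sgn a)"

lemma abs_slope_le_1: "\<bar>abs_slope a b\<bar> \<le> 1"
  by (simp add: abs_slope_def abs_sgn_eq)

text \<open>At \<open>a = 0\<close> every number in [-1, 1] is a subgradient of \<open>abs\<close>,
  elsewhere \<open>sgn a\<close> is. Since \<open>y\<close> is unrelated to \<open>b\<close>, the
  slope taken at a weak limit can be tested against the members of the sequence.\<close>

lemma abs_slope_subgradient: "\<bar>a\<bar> + abs_slope a b * y \<le> \<bar>a + y\<bar>"
  by (auto simp: abs_slope_def sgn_if)

lemma abs_slope_measurable [measurable]:
  assumes [measurable]: "f \<in> borel_measurable M" "g \<in> borel_measurable M"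
  shows "(\<lambda>x. abs_slope (f x) (g x)) \<in> borel_measurable M"
  unfolding abs_slope_def sgn_if by measurable

lemma (in finite_measure) abs_slope_L2:
  assumes "f \<in> L2 M" "g \<in> L2 M"
  shows "(\<lambda>x. abs_slope (f x) (g x)) \<in> L2 M"
  by (rule L2_bounded[where c = 1, OF abs_slope_measurable])
     (fact L2_measurable[OF assms(1)] L2_measurable[OF assms(2)] abs_slope_le_1)+

text \<open>A nonzero \<open>a\<close> keeps its sign along small steps, and at \<open>a = 0\<close>
  the absolute value is positively homogeneous. Hence the expansion has no remainder at all.\<close>

lemma eventually_abs_affine:
  "\<forall>\<^sub>F s in at_right 0. \<bar>a + s * b\<bar> = \<bar>a\<bar> + s * (abs_slope a b * b)"
proof (cases "a = 0")
  case True
  have "\<forall>\<^sub>F s in at_right 0. s > (0::real)" by (rule eventually_at_right_less)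
  then show ?thesis
    by eventually_elim (use True in \<open>auto simp: abs_slope_def abs_mult sgn_if\<close>)
next
  case False
  have "((\<lambda>s. a + s * b) \<longlongrightarrow> a + 0 * b) (at_right 0)"
    by (intro tendsto_intros)
  then have lim: "((\<lambda>s. a + s * b) \<longlongrightarrow> a) (at_right 0)" by simp
  show ?thesis
  proof (cases "a > 0")
    case True
    with order_tendstoD(1)[OF lim, of 0] have "\<forall>\<^sub>F s in at_right 0. 0 < a + s * b" by simp
    then show ?thesis
      by eventually_elim (use True in \<open>simp add: abs_slope_def\<close>)
  next
    case neg: False
    with False order_tendstoD(2)[OF lim, of 0] have "\<forall>\<^sub>F s in at_right 0. a + s * b < 0" by simp
    then show ?thesis
      by eventually_elim (use neg False in \<open>simp add: abs_slope_def sgn_if\<close>)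
  qed
qed

lemma eventually_le_upper:
  fixes a b c :: real
  assumes "a \<le> c" "a = c \<Longrightarrow> b \<le> 0"
  shows "\<forall>\<^sub>F s in at_right 0. a + s * b \<le> c"
proof (cases "a = c")
  case True
  have "\<forall>\<^sub>F s in at_right 0. s > (0::real)" by (rule eventually_at_right_less)
  then show ?thesis
    by eventually_elim (use True assms(2) in \<open>auto simp: mult_nonneg_nonpos\<close>)
next
  case False
  have "((\<lambda>s. a + s * b) \<longlongrightarrow> a + 0 * b) (at_right 0)"
    by (intro tendsto_intros)
  then have "\<forall>\<^sub>F s in at_right 0. a + s * b < c"
    by (rule order_tendstoD(2)) (use False assms(1) in simp)
  then show ?thesis by eventually_elim simp
qed

text \<open>Joins the two pointwise properties that truncation has to secure: feasibility of the
  step, and an increment of \<open>abs\<close> without remainder.\<close>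

definition exact_step :: "real \<Rightarrow> real \<Rightarrow> real \<Rightarrow> real \<Rightarrow> real \<Rightarrow> bool" where
  "exact_step \<alpha> \<beta> s a b \<longleftrightarrow>
     \<alpha> \<le> a + s * b \<and> a + s * b \<le> \<beta> \<and> \<bar>a + s * b\<bar> = \<bar>a\<bar> + s * (abs_slope a b * b)"

lemma eventually_exact_step:
  assumes "\<alpha> \<le> a" "a \<le> \<beta>" "a = \<alpha> \<Longrightarrow> 0 \<le> b" "a = \<beta> \<Longrightarrow> b \<le> 0"
  shows "\<forall>\<^sub>F s in at_right 0. exact_step \<alpha> \<beta> s a b"
proof -
  \<comment> \<open>The lower bound is the upper-bound lemma applied to \<open>- a\<close>,
    \<open>- b\<close> and \<open>- \<alpha>\<close>.\<close>
  have "\<forall>\<^sub>F s in at_right 0. - a + s * - b \<le> - \<alpha>"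
    by (rule eventually_le_upper) (use assms in auto)
  moreover have "\<forall>\<^sub>F s in at_right 0. a + s * b \<le> \<beta>"
    by (rule eventually_le_upper) (use assms in auto)
  ultimately show ?thesis
    using eventually_abs_affine[of a b]
    by eventually_elim (simp add: exact_step_def)
qed

lemma decr_to_zero_at_right: "decr_to_zero t \<Longrightarrow> filterlim t (at_right 0) sequentially"
  unfolding decr_to_zero_def filterlim_at
  by (auto intro!: always_eventually simp: less_imp_neq[symmetric])

text \<open>Dominated convergence: at each point the difference quotients are eventually constant,
  and all are bounded by \<bar>v\<bar>, which is integrable because the measure is finite.\<close>

lemma (in finite_measure) dir_deriv_j1:
  assumes "u \<in> L2 M" "v \<in> L2 M"
  shows "dir_deriv (j1 M) u v = (\<integral>x. abs_slope (u x) (v x) * v x \<partial>M)"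
proof -
  note [measurable] = L2_measurable[OF assms(1)] L2_measurable[OF assms(2)]
  have "((\<lambda>s. (j1 M (\<lambda>x. u x + s * v x) - j1 M u) / s)
      \<longlongrightarrow> (\<integral>x. abs_slope (u x) (v x) * v x \<partial>M)) (at_right 0)"
  \<comment> \<open>Dominated convergence is about sequences, so the one-sided limit is tested along
    sequences between 0 and 1; the right end 1 is arbitrary.\<close>
  proof (rule tendsto_at_right_sequentially[of 0 1])
    fix S :: "nat \<Rightarrow> real"
    assume S: "\<And>n. 0 < S n" "S \<longlonglongrightarrow> 0"
    then have t: "decr_to_zero S" by (simp add: decr_to_zero_def)
    have "(\<lambda>n. \<integral>x. (\<bar>u x + S n * v x\<bar> - \<bar>u x\<bar>) / S n \<partial>M)
        \<longlonglongrightarrow> (\<integral>x. abs_slope (u x) (v x) * v x \<partial>M)"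
    proof (rule integral_dominated_convergence[where w = "\<lambda>x. \<bar>v x\<bar>"])
      show "integrable M (\<lambda>x. \<bar>v x\<bar>)"
        using L2_integrable[OF assms(2)] by simp
      show "AE x in M. (\<lambda>n. (\<bar>u x + S n * v x\<bar> - \<bar>u x\<bar>) / S n) \<longlonglongrightarrow> abs_slope (u x) (v x) * v x"
      proof (rule AE_I2)
        fix x
        have "\<forall>\<^sub>F n in sequentially.
            \<bar>u x + S n * v x\<bar> = \<bar>u x\<bar> + S n * (abs_slope (u x) (v x) * v x)"
          by (rule eventually_compose_filterlim[OF eventually_abs_affine decr_to_zero_at_right[OF t]])
        then have "\<forall>\<^sub>F n in sequentially.
            (\<bar>u x + S n * v x\<bar> - \<bar>u x\<bar>) / S n = abs_slope (u x) (v x) * v x"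
          by eventually_elim (use S(1) in \<open>simp add: less_imp_neq[symmetric]\<close>)
        then show "(\<lambda>n. (\<bar>u x + S n * v x\<bar> - \<bar>u x\<bar>) / S n) \<longlonglongrightarrow> abs_slope (u x) (v x) * v x"
          by (rule tendsto_eventually)
      qed
      show "AE x in M. norm ((\<bar>u x + S n * v x\<bar> - \<bar>u x\<bar>) / S n) \<le> \<bar>v x\<bar>" for n
      proof (rule AE_I2)
        fix x
        have "\<bar>\<bar>u x + S n * v x\<bar> - \<bar>u x\<bar>\<bar> \<le> \<bar>S n * v x\<bar>" by linarith
        also have "\<dots> = \<bar>v x\<bar> * S n" using S(1)[of n] by (simp add: abs_mult)
        finally show "norm ((\<bar>u x + S n * v x\<bar> - \<bar>u x\<bar>) / S n) \<le> \<bar>v x\<bar>"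
          using S(1)[of n] by (simp add: pos_divide_le_eq)
      qed
    qed measurable
    moreover have "(\<integral>x. (\<bar>u x + S n * v x\<bar> - \<bar>u x\<bar>) / S n \<partial>M)
        = (j1 M (\<lambda>x. u x + S n * v x) - j1 M u) / S n" for n
    proof -
      have "(\<integral>x. \<bar>u x + S n * v x\<bar> - \<bar>u x\<bar> \<partial>M) = j1 M (\<lambda>x. u x + S n * v x) - j1 M u"
        unfolding j1_def
        by (intro Bochner_Integration.integral_diff integrable_abs L2_integrable L2_add L2_cmult
              assms(1,2))
      then show ?thesis by (simp only: integral_divide_zero)
    qed
    ultimately show "(\<lambda>n. (j1 M (\<lambda>x. u x + S n * v x) - j1 M u) / S n)
        \<longlonglongrightarrow> (\<integral>x. abs_slope (u x) (v x) * v x \<partial>M)"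
      by (simp only:)
  qed simp
  then show ?thesis
    unfolding dir_deriv_def by (intro tendsto_Lim) simp_all
qed

section \<open>Second-order quotients\<close>

text \<open>\<open>G1\<close> is finite at the admissible \<open>u\<close>, so no difference of
  infinities occurs, and an infeasible step is the only source of an infinite value.\<close>

lemma second_quotient_G1:
  assumes "u \<in> U_ad M \<alpha> \<beta>"
  shows "second_quotient M (G1 M \<alpha> \<beta> \<mu>) u w s V =
    (if (\<lambda>x. u x + s * V x) \<in> U_ad M \<alpha> \<beta>
     then ereal ((\<mu> * (j1 M (\<lambda>x. u x + s * V x) - j1 M u) - s * L2_inner M w V) / (s\<^sup>2 / 2))
     else \<infinity> / ereal (s\<^sup>2 / 2))"
  using assms by (simp add: second_quotient_def G1_def indicator_fun_def right_diff_distrib)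

text \<open>Points where the direction is set to 0 do not move and so stay feasible.
  \<open>B\<close> is the set of wrong sign in the sign argument and the whole space for recovery
  sequences.\<close>

definition trunc_dir :: "real \<Rightarrow> real \<Rightarrow> ('a \<Rightarrow> real) \<Rightarrow> ('a \<Rightarrow> real) \<Rightarrow> 'a set \<Rightarrow> real \<Rightarrow>
     'a \<Rightarrow> real" where
  "trunc_dir \<alpha> \<beta> u v B s x = (if x \<in> B \<and> exact_step \<alpha> \<beta> s (u x) (v x) then v x else 0)"

section \<open>A fixed subgradient \<open>w\<close> of \<open>G1\<close> at \<open>u\<close> over a
  finite measure\<close>

locale G1_subgradient = finite_measure M for M :: "'a measure" +
  fixes \<alpha> \<beta> \<mu> :: real and u w :: "'a \<Rightarrow> real"
  assumes \<mu>_pos: "\<mu> > 0"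
    and u_ad: "u \<in> U_ad M \<alpha> \<beta>"
    and subgradient: "w \<in> L2_subdifferential M (G1 M \<alpha> \<beta> \<mu>) u"
begin

text \<open>Multiplied by \<open>v\<close> and integrated, this is the directional derivative of
  \<mu> \<open>j1\<close> minus the pairing with \<open>w\<close>. With \<open>w\<close> equal to
  minus the derivative of \<open>F\<close>, it is the expression that vanishes on the critical
  cone.\<close>

abbreviation first_order :: "('a \<Rightarrow> real) \<Rightarrow> 'a \<Rightarrow> real" where
  "first_order v x \<equiv> \<mu> * abs_slope (u x) (v x) - w x"

abbreviation quotient :: "real \<Rightarrow> ('a \<Rightarrow> real) \<Rightarrow> ereal" where
  "quotient \<equiv> second_quotient M (G1 M \<alpha> \<beta> \<mu>) u w"

lemma u_L2: "u \<in> L2 M"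
  using u_ad by (simp add: U_ad_def)

lemma w_L2: "w \<in> L2 M"
  using subgradient by (simp add: L2_subdifferential_def)

lemma first_order_L2:
  assumes "v \<in> L2 M"
  shows "first_order v \<in> L2 M"
  using L2_add[OF L2_cmult[OF abs_slope_L2[OF u_L2 assms], of \<mu>] L2_cmult[OF w_L2, of "-1"]]
  by simp

lemma integral_first_order:
  assumes "v \<in> L2 M" "V \<in> L2 M"
  shows "(\<integral>x. first_order v x * V x \<partial>M)
      = \<mu> * (\<integral>x. abs_slope (u x) (v x) * V x \<partial>M) - L2_inner M w V"
proof -
  note int = L2_mult_integrable[OF abs_slope_L2[OF u_L2 assms(1)] assms(2)]
    L2_mult_integrable[OF w_L2 assms(2)]
  have "(\<integral>x. first_order v x * V x \<partial>M)
      = (\<integral>x. \<mu> * (abs_slope (u x) (v x) * V x) - w x * V x \<partial>M)"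
    by (simp only: left_diff_distrib mult.assoc)
  also have "\<dots> = (\<integral>x. \<mu> * (abs_slope (u x) (v x) * V x) \<partial>M) - (\<integral>x. w x * V x \<partial>M)"
    by (intro Bochner_Integration.integral_diff integrable_mult_right int)
  finally show ?thesis by (simp only: integral_mult_right_zero L2_inner_def)
qed

lemma integral_abs_affine:
  assumes "v \<in> L2 M" "V \<in> L2 M"
  shows "(\<integral>x. \<bar>u x\<bar> + s * (abs_slope (u x) (v x) * V x) \<partial>M)
      = j1 M u + s * (\<integral>x. abs_slope (u x) (v x) * V x \<partial>M)"
proof -
  have "(\<integral>x. \<bar>u x\<bar> + s * (abs_slope (u x) (v x) * V x) \<partial>M)
      = j1 M u + (\<integral>x. s * (abs_slope (u x) (v x) * V x) \<partial>M)"
    unfolding j1_def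
    by (intro Bochner_Integration.integral_add integrable_mult_right integrable_abs
          L2_integrable L2_mult_integrable abs_slope_L2 u_L2 assms)
  then show ?thesis by (simp only: integral_mult_right_zero)
qed

text \<open>For a feasible step this is the subgradient inequality at the shifted point, divided by
  \<open>s\<^sup>2 / 2\<close>; for an infeasible one the quotient is infinite.\<close>

lemma quotient_nonneg:
  assumes "V \<in> L2 M" "s > 0"
  shows "0 \<le> quotient s V"
proof (cases "(\<lambda>x. u x + s * V x) \<in> U_ad M \<alpha> \<beta>")
  case True
  then have "(\<lambda>x. u x + s * V x) \<in> L2 M" by (simp add: U_ad_def)
  with subgradient have "G1 M \<alpha> \<beta> \<mu> u + ereal (L2_inner M w (\<lambda>x. (u x + s * V x) - u x))
      \<le> G1 M \<alpha> \<beta> \<mu> (\<lambda>x. u x + s * V x)"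
    by (auto simp: L2_subdifferential_def)
  moreover have "L2_inner M w (\<lambda>x. (u x + s * V x) - u x) = s * L2_inner M w V"
    by (simp add: L2_inner_def mult.left_commute[of _ s])
  ultimately have "0 \<le> \<mu> * (j1 M (\<lambda>x. u x + s * V x) - j1 M u) - s * L2_inner M w V"
    using True u_ad by (simp add: G1_def indicator_fun_def right_diff_distrib)
  with True u_ad assms(2) show ?thesis by (simp add: second_quotient_G1)
next
  case False
  with u_ad assms(2) show ?thesis by (simp add: second_quotient_G1)
qed

text \<open>Every point either does not move or makes an exact step, so the shifted function is
  admissible and the increment of \<open>G1\<close> is exactly linear in \<open>s\<close>. Only the
  first-order integral survives.\<close>

lemma quotient_trunc_dir:
  assumes "v \<in> L2 M" "B \<in> sets M" "s > 0"
  defines "V \<equiv> trunc_dir \<alpha> \<beta> u v B s"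
  shows "V \<in> L2 M"
    and "quotient s V = ereal (s * (\<integral>x. first_order v x * V x \<partial>M) / (s\<^sup>2 / 2))"
proof -
  note [measurable] = L2_measurable[OF u_L2] L2_measurable[OF assms(1)] assms(2)
  have "V = (\<lambda>x. if x \<in> B \<and> exact_step \<alpha> \<beta> s (u x) (v x) then v x else 0)"
    by (simp add: fun_eq_iff V_def trunc_dir_def)
  also have "\<dots> \<in> borel_measurable M"
    unfolding exact_step_def by measurable
  finally have V_borel: "V \<in> borel_measurable M" .
  show V: "V \<in> L2 M"
    by (rule L2_dominated[OF assms(1) V_borel]) (simp add: V_def trunc_dir_def)
  have uV: "(\<lambda>x. u x + s * V x) \<in> L2 M"
    by (intro L2_add L2_cmult u_L2 V)
  have ad: "(\<lambda>x. u x + s * V x) \<in> U_ad M \<alpha> \<beta>"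
    using uV u_ad by (auto simp: U_ad_def V_def trunc_dir_def exact_step_def)
  \<comment> \<open>Where \<open>V x = 0\<close> both sides equal \<bar>u x\<bar>, so the identity
    holds at every point although the slope is that of \<open>v\<close>.\<close>
  have affine: "\<bar>u x + s * V x\<bar> = \<bar>u x\<bar> + s * (abs_slope (u x) (v x) * V x)" for x
    by (simp add: V_def trunc_dir_def exact_step_def)
  have "j1 M (\<lambda>x. u x + s * V x) = (\<integral>x. \<bar>u x\<bar> + s * (abs_slope (u x) (v x) * V x) \<partial>M)"
    unfolding j1_def affine ..
  also have "\<dots> = j1 M u + s * (\<integral>x. abs_slope (u x) (v x) * V x \<partial>M)"
    by (rule integral_abs_affine[OF assms(1) V])
  finally have incr: "j1 M (\<lambda>x. u x + s * V x)
      = j1 M u + s * (\<integral>x. abs_slope (u x) (v x) * V x \<partial>M)" .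
  have "\<mu> * (j + s * i - j) - s * l = s * (\<mu> * i - l)" for j i l
    by (simp add: algebra_simps)
  then have "\<mu> * (j1 M (\<lambda>x. u x + s * V x) - j1 M u) - s * L2_inner M w V
      = s * (\<integral>x. first_order v x * V x \<partial>M)"
    unfolding integral_first_order[OF assms(1) V] incr by blast
  then show "quotient s V = ereal (s * (\<integral>x. first_order v x * V x \<partial>M) / (s\<^sup>2 / 2))"
    by (simp only: second_quotient_G1[OF u_ad] ad if_True)
qed

section \<open>Sign of the first-order integrand and the critical cone\<close>

lemma tangent_exact_step:
  assumes "v \<in> tangent_cone M \<alpha> \<beta> u" "decr_to_zero t"
  shows "AE x in M. \<forall>\<^sub>F k in sequentially. exact_step \<alpha> \<beta> (t k) (u x) (v x)"
proof -
  have "AE x in M. \<alpha> \<le> u x \<and> u x \<le> \<beta>" using u_ad by (simp add: U_ad_def)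
  moreover have "AE x in M. (u x = \<alpha> \<longrightarrow> 0 \<le> v x) \<and> (u x = \<beta> \<longrightarrow> v x \<le> 0)"
    using assms(1) by (simp add: tangent_cone_def)
  ultimately show ?thesis
    by eventually_elim
       (rule eventually_compose_filterlim[OF eventually_exact_step decr_to_zero_at_right[OF assms(2)]],
        auto)
qed

text \<open>Truncations of \<open>v\<close> to the set \<open>B\<close> of wrong sign have a
  first-order integral that is nonpositive by choice of \<open>B\<close> and nonnegative by the
  subgradient inequality. So the integrand vanishes, and since almost every point makes an exact
  step for some \<open>n\<close>, \<open>B\<close> is null.\<close>

lemma first_order_nonneg:
  assumes "v \<in> tangent_cone M \<alpha> \<beta> u"
  shows "AE x in M. 0 \<le> first_order v x * v x"
proof -
  have v: "v \<in> L2 M" using assms by (simp add: tangent_cone_def)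
  note [measurable] = L2_measurable[OF u_L2] L2_measurable[OF v] L2_measurable[OF w_L2]
  \<comment> \<open>Any positive null sequence serves; countability lets the exceptional null sets
    be united.\<close>
  define t :: "nat \<Rightarrow> real" where "t n = 1 / Suc n" for n
  have t: "decr_to_zero t"
    unfolding decr_to_zero_def t_def using lim_inverse_n' LIMSEQ_Suc by fastforce
  define B where "B = {x \<in> space M. first_order v x * v x < 0}"
  have B: "B \<in> sets M" unfolding B_def by measurable
  have "AE x in M. first_order v x * trunc_dir \<alpha> \<beta> u v B (t n) x = 0" for n
  proof -
    let ?V = "trunc_dir \<alpha> \<beta> u v B (t n)"
    have tn: "t n > 0" using t by (simp add: decr_to_zero_def)
    note V = quotient_trunc_dir[OF v B tn]
    have "0 \<le> (\<integral>x. first_order v x * ?V x \<partial>M)"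
      using quotient_nonneg[OF V(1) tn] tn unfolding V(2)
      by (simp add: zero_le_divide_iff zero_le_mult_iff)
    moreover have int: "integrable M (\<lambda>x. first_order v x * ?V x)"
      by (rule L2_mult_integrable[OF first_order_L2[OF v] V(1)])
    moreover have nonpos: "first_order v x * ?V x \<le> 0" for x
      by (auto simp: trunc_dir_def B_def)
    ultimately have "(\<integral>x. - (first_order v x * ?V x) \<partial>M) = 0"
      using integral_nonneg_AE[of "\<lambda>x. - (first_order v x * ?V x)" M] by simp
    then have "AE x in M. - (first_order v x * ?V x) = 0"
      using int nonpos
      by (subst (asm) integral_nonneg_eq_0_iff_AE) auto
    then show ?thesis by simp
  qed
  then have "AE x in M. \<forall>n. first_order v x * trunc_dir \<alpha> \<beta> u v B (t n) x = 0"
    by (subst AE_all_countable) blast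
  with tangent_exact_step[OF assms t] AE_space show ?thesis
  proof eventually_elim
    case (elim x)
    from elim(1) obtain n where n: "exact_step \<alpha> \<beta> (t n) (u x) (v x)"
      by (auto simp: eventually_sequentially)
    show ?case
    proof (rule ccontr)
      assume "\<not> ?case"
      with elim(2,3) n have "first_order v x * v x = 0"
        by (auto simp: trunc_dir_def B_def split: if_splits)
      with \<open>\<not> ?case\<close> show False by simp
    qed
  qed
qed

lemma critical_cone_iff:
  "v \<in> critical_cone M \<alpha> \<beta> \<mu> (\<lambda>x. - w x) u \<longleftrightarrow>
     v \<in> tangent_cone M \<alpha> \<beta> u \<and> (\<integral>x. first_order v x * v x \<partial>M) = 0"
proof (cases "v \<in> tangent_cone M \<alpha> \<beta> u")
  case True
  then have v: "v \<in> L2 M" by (simp add: tangent_cone_def)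
  have "(\<integral>x. first_order v x * v x \<partial>M) = L2_inner M (\<lambda>x. - w x) v + \<mu> * dir_deriv (j1 M) u v"
    using dir_deriv_j1[OF u_L2 v] integral_first_order[OF v v]
    by (simp add: L2_inner_def)
  then show ?thesis using True by (simp add: critical_cone_def)
qed (simp add: critical_cone_def)

section \<open>Recovery sequences on the critical cone\<close>

text \<open>A nonnegative integrand with zero integral vanishes almost everywhere, so all
  truncations of \<open>v\<close> have quotient 0. They equal \<open>v\<close> eventually at almost
  every point, and the squared error is dominated by the square of \<open>v\<close>.\<close>

lemma critical_recovery_sequence:
  assumes "v \<in> critical_cone M \<alpha> \<beta> \<mu> (\<lambda>x. - w x) u" "decr_to_zero t"
  shows "\<exists>V. L2_strong_conv M V v \<and> (\<forall>k. quotient (t k) (V k) = 0)"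
proof -
  from assms(1) have tan: "v \<in> tangent_cone M \<alpha> \<beta> u"
    and zero: "(\<integral>x. first_order v x * v x \<partial>M) = 0"
    by (simp_all add: critical_cone_iff)
  have v: "v \<in> L2 M" using tan by (simp add: tangent_cone_def)
  note [measurable] = L2_measurable[OF v]
  have tk: "t k > 0" for k using assms(2) by (simp add: decr_to_zero_def)
  define V where "V k = trunc_dir \<alpha> \<beta> u v (space M) (t k)" for k
  note V = quotient_trunc_dir[OF v sets.top tk, folded V_def]
  have [measurable]: "V k \<in> borel_measurable M" for k using V(1) by (rule L2_measurable)
  have "AE x in M. first_order v x * v x = 0"
    using zero L2_mult_integrable[OF first_order_L2[OF v] v] first_order_nonneg[OF tan]
    by (simp add: integral_nonneg_eq_0_iff_AE)
  \<comment> \<open>Pointwise \<open>V k\<close> is \<open>v\<close> or 0, so this integrand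
    vanishes wherever the one for \<open>v\<close> does.\<close>
  then have "(\<integral>x. first_order v x * V k x \<partial>M) = 0" for k
    by (intro integral_eq_zero_AE) (auto simp: V_def trunc_dir_def)
  then have "quotient (t k) (V k) = 0" for k
    by (simp add: V(2) zero_ereal_def)
  moreover have "(\<lambda>k. \<integral>x. (V k x - v x) * (V k x - v x) \<partial>M) \<longlonglongrightarrow> (\<integral>x. 0 \<partial>M)"
  proof (rule integral_dominated_convergence[where w = "\<lambda>x. (v x)\<^sup>2"])
    show "integrable M (\<lambda>x. (v x)\<^sup>2)" using v by (rule L2_square_integrable)
    show "AE x in M. (\<lambda>k. (V k x - v x) * (V k x - v x)) \<longlonglongrightarrow> 0"
      using tangent_exact_step[OF tan assms(2)] AE_space
    proof eventually_elim
      case (elim x)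
      from elim(1) have "\<forall>\<^sub>F k in sequentially. (V k x - v x) * (V k x - v x) = 0"
        by eventually_elim (use elim(2) in \<open>simp add: V_def trunc_dir_def\<close>)
      then show ?case by (rule tendsto_eventually)
    qed
    show "AE x in M. norm ((V k x - v x) * (V k x - v x)) \<le> (v x)\<^sup>2" for k
      by (auto simp: V_def trunc_dir_def power2_eq_square)
  qed measurable
  then have "L2_strong_conv M V v"
    using V(1) v tendsto_real_sqrt by (fastforce simp: L2_strong_conv_def L2_norm_def L2_inner_def)
  ultimately show ?thesis by blast
qed

section \<open>Behaviour off the critical cone\<close>

text \<open>Testing weak convergence with the indicator of the part of \<open>A\<close> where
  \<open>v\<close> is negative. Infinitely many nonnegative members suffice, as they already force
  the limit of the pairings to be nonnegative.\<close>

lemma weak_limit_nonneg_on: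
  assumes "L2_weak_conv M V v" "A \<in> sets M"
    and "\<exists>\<^sub>F k in sequentially. AE x in M. x \<in> A \<longrightarrow> 0 \<le> V k x"
  shows "AE x in M. x \<in> A \<longrightarrow> 0 \<le> v x"
proof -
  have v: "v \<in> L2 M" using assms(1) by (simp add: L2_weak_conv_def)
  note [measurable] = L2_measurable[OF v] assms(2)
  define \<phi> where "\<phi> x = (if x \<in> A \<and> v x < 0 then 1 else 0 :: real)" for x
  have "\<phi> \<in> L2 M"
    by (rule L2_bounded[where c = 1]) (auto simp: \<phi>_def[abs_def])
  then have "(\<lambda>k. L2_inner M \<phi> (V k)) \<longlonglongrightarrow> L2_inner M \<phi> v"
    using assms(1) by (simp add: L2_weak_conv_def)
  moreover have "\<exists>\<^sub>F k in sequentially. 0 \<le> L2_inner M \<phi> (V k)"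
    using assms(3)
  proof (rule frequently_mono[rotated], intro allI impI)
    fix k assume "AE x in M. x \<in> A \<longrightarrow> 0 \<le> V k x"
    then show "0 \<le> L2_inner M \<phi> (V k)"
      unfolding L2_inner_def by (intro integral_nonneg_AE) (auto simp: \<phi>_def)
  qed
  ultimately have "0 \<le> L2_inner M \<phi> v"
    using order_tendstoD(2)[of _ "L2_inner M \<phi> v" sequentially 0]
    by (fastforce simp: frequently_def not_le)
  moreover have int: "integrable M (\<lambda>x. \<phi> x * v x)"
    by (rule L2_mult_integrable[OF \<open>\<phi> \<in> L2 M\<close> v])
  moreover have nonpos: "\<phi> x * v x \<le> 0" for x by (simp add: \<phi>_def)
  ultimately have "(\<integral>x. - (\<phi> x * v x) \<partial>M) = 0"
    using integral_nonneg_AE[of "\<lambda>x. - (\<phi> x * v x)" M] by (simp add: L2_inner_def)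
  then have "AE x in M. - (\<phi> x * v x) = 0"
    using int nonpos by (subst (asm) integral_nonneg_eq_0_iff_AE) auto
  then show ?thesis by eventually_elim (auto simp: \<phi>_def split: if_splits)
qed

text \<open>On the active sets a feasible step fixes the sign of \<open>V k\<close>, and the sign
  survives the weak limit. With \<open>frequently\<close> in the premise, the contrapositive says
  that outside the tangent cone the steps are eventually infeasible.\<close>

lemma weak_limit_feasible_tangent:
  assumes "decr_to_zero t" and weak: "L2_weak_conv M V v"
    and feasible: "\<exists>\<^sub>F k in sequentially. (\<lambda>x. u x + t k * V k x) \<in> U_ad M \<alpha> \<beta>"
  shows "v \<in> tangent_cone M \<alpha> \<beta> u"
proof -
  have tk: "t k > 0" for k using assms(1) by (simp add: decr_to_zero_def)
  have v: "v \<in> L2 M" using weak by (simp add: L2_weak_conv_def)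
  note [measurable] = L2_measurable[OF u_L2]
  have weak_uminus: "L2_weak_conv M (\<lambda>k x. - V k x) (\<lambda>x. - v x)"
    using weak L2_cmult[of _ M "-1"]
    by (auto simp: L2_weak_conv_def L2_inner_def intro!: tendsto_minus)
  have "AE x in M. x \<in> {x \<in> space M. u x = \<alpha>} \<longrightarrow> 0 \<le> v x"
  proof (rule weak_limit_nonneg_on[OF weak])
    show "\<exists>\<^sub>F k in sequentially. AE x in M. x \<in> {x \<in> space M. u x = \<alpha>} \<longrightarrow> 0 \<le> V k x"
      using feasible
    proof (rule frequently_mono[rotated], intro allI impI)
      fix k assume "(\<lambda>x. u x + t k * V k x) \<in> U_ad M \<alpha> \<beta>"
      then have "AE x in M. \<alpha> \<le> u x + t k * V k x" by (auto simp: U_ad_def)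
      then show "AE x in M. x \<in> {x \<in> space M. u x = \<alpha>} \<longrightarrow> 0 \<le> V k x"
        by eventually_elim (use tk[of k] in \<open>auto simp: zero_le_mult_iff\<close>)
    qed
  qed measurable
  moreover have "AE x in M. x \<in> {x \<in> space M. u x = \<beta>} \<longrightarrow> 0 \<le> - v x"
  proof (rule weak_limit_nonneg_on[OF weak_uminus])
    show "\<exists>\<^sub>F k in sequentially. AE x in M. x \<in> {x \<in> space M. u x = \<beta>} \<longrightarrow> 0 \<le> - V k x"
      using feasible
    proof (rule frequently_mono[rotated], intro allI impI)
      fix k assume "(\<lambda>x. u x + t k * V k x) \<in> U_ad M \<alpha> \<beta>"
      then have "AE x in M. u x + t k * V k x \<le> \<beta>" by (auto simp: U_ad_def)
      then show "AE x in M. x \<in> {x \<in> space M. u x = \<beta>} \<longrightarrow> 0 \<le> - V k x"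
        by eventually_elim (use tk[of k] in \<open>auto simp: mult_le_0_iff\<close>)
    qed
  qed measurable
  ultimately have "AE x in M. (u x = \<alpha> \<longrightarrow> 0 \<le> v x) \<and> (u x = \<beta> \<longrightarrow> v x \<le> 0)"
    using AE_space by eventually_elim auto
  with v show ?thesis by (simp add: tangent_cone_def)
qed

text \<open>The slopes formed with \<open>v\<close> are subgradients of \<open>abs\<close> along
  \<open>u\<close>, whatever \<open>V\<close> is. The resulting bound is linear in \<open>V\<close>,
  so its integral passes to weak limits.\<close>

lemma quotient_lower_bound:
  assumes "v \<in> L2 M" "V \<in> L2 M" "s > 0"
  shows "ereal ((\<integral>x. first_order v x * V x \<partial>M) * (2 / s)) \<le> quotient s V"
proof (cases "(\<lambda>x. u x + s * V x) \<in> U_ad M \<alpha> \<beta>")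
  case True
  note int = L2_integrable[OF u_L2] L2_mult_integrable[OF abs_slope_L2[OF u_L2 assms(1)] assms(2)]
    L2_integrable[OF L2_add[OF u_L2 L2_cmult[OF assms(2)]]]
  have "j1 M u + s * (\<integral>x. abs_slope (u x) (v x) * V x \<partial>M)
      = (\<integral>x. \<bar>u x\<bar> + s * (abs_slope (u x) (v x) * V x) \<partial>M)"
    by (rule integral_abs_affine[OF assms(1,2), symmetric])
  also have "\<dots> \<le> j1 M (\<lambda>x. u x + s * V x)"
    unfolding j1_def
  proof (rule integral_mono)
    show "\<bar>u x\<bar> + s * (abs_slope (u x) (v x) * V x) \<le> \<bar>u x + s * V x\<bar>" for x
      using abs_slope_subgradient[of "u x" "v x" "s * V x"] by (simp add: mult.left_commute)
    show "integrable M (\<lambda>x. \<bar>u x\<bar> + s * (abs_slope (u x) (v x) * V x))"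
      by (intro Bochner_Integration.integrable_add integrable_mult_right integrable_abs int)
    show "integrable M (\<lambda>x. \<bar>u x + s * V x\<bar>)"
      by (intro integrable_abs int)
  qed
  finally have "\<mu> * (s * (\<integral>x. abs_slope (u x) (v x) * V x \<partial>M))
      \<le> \<mu> * (j1 M (\<lambda>x. u x + s * V x) - j1 M u)"
    using \<mu>_pos by (intro mult_left_mono) auto
  then have "s * (\<integral>x. first_order v x * V x \<partial>M)
      \<le> \<mu> * (j1 M (\<lambda>x. u x + s * V x) - j1 M u) - s * L2_inner M w V"
    unfolding integral_first_order[OF assms(1,2)] by (simp only: right_diff_distrib mult.left_commute)
  then have "s * (\<integral>x. first_order v x * V x \<partial>M) / (s\<^sup>2 / 2)
      \<le> (\<mu> * (j1 M (\<lambda>x. u x + s * V x) - j1 M u) - s * L2_inner M w V) / (s\<^sup>2 / 2)"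
    by (rule divide_right_mono) simp
  moreover have "s * (\<integral>x. first_order v x * V x \<partial>M) / (s\<^sup>2 / 2)
      = (\<integral>x. first_order v x * V x \<partial>M) * (2 / s)"
    using assms(3) by (simp add: power2_eq_square)
  ultimately show ?thesis using True u_ad by (simp add: second_quotient_G1)
next
  case False
  with u_ad assms(3) show ?thesis by (simp add: second_quotient_G1)
qed

text \<open>For tangent \<open>v\<close> the first-order integrals converge to a positive number and
  are multiplied by \<open>2 / t k\<close>; for other \<open>v\<close> the steps become
  infeasible.\<close>

lemma noncritical_quotient_tendsto:
  assumes "v \<notin> critical_cone M \<alpha> \<beta> \<mu> (\<lambda>x. - w x) u" "decr_to_zero t" "L2_weak_conv M V v"
  shows "(\<lambda>k. quotient (t k) (V k)) \<longlonglongrightarrow> \<infinity>"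
proof (cases "v \<in> tangent_cone M \<alpha> \<beta> u")
  case True
  have v: "v \<in> L2 M" and V: "\<And>k. V k \<in> L2 M"
    using assms(3) by (auto simp: L2_weak_conv_def)
  have tk: "t k > 0" for k using assms(2) by (simp add: decr_to_zero_def)
  have "0 \<le> (\<integral>x. first_order v x * v x \<partial>M)"
    by (rule integral_nonneg_AE[OF first_order_nonneg[OF True]])
  with assms(1) True have pos: "0 < (\<integral>x. first_order v x * v x \<partial>M)"
    by (simp add: critical_cone_iff)
  have lim: "(\<lambda>k. \<integral>x. first_order v x * V k x \<partial>M) \<longlonglongrightarrow> (\<integral>x. first_order v x * v x \<partial>M)"
    using assms(3) first_order_L2[OF v] by (auto simp: L2_weak_conv_def L2_inner_def)
  have "filterlim (\<lambda>k. 2 * inverse (t k)) at_top sequentially"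
    by (rule filterlim_tendsto_pos_mult_at_top[OF tendsto_const zero_less_numeral
          filterlim_compose[OF filterlim_inverse_at_top_right decr_to_zero_at_right[OF assms(2)]]])
  then have "filterlim (\<lambda>k. (\<integral>x. first_order v x * V k x \<partial>M) * (2 / t k)) at_top sequentially"
    using filterlim_tendsto_pos_mult_at_top[OF lim pos] by (simp add: divide_inverse)
  then have "(\<lambda>k. ereal ((\<integral>x. first_order v x * V k x \<partial>M) * (2 / t k))) \<longlonglongrightarrow> \<infinity>"
    by (simp add: tendsto_PInfty_eq_at_top)
  then show ?thesis
    \<comment> \<open>The sandwich is between the diverging lower bound and the constant
      \<infinity>.\<close>
    by (rule tendsto_sandwich[OF _ _ _ tendsto_const, rotated 2])
       (simp_all only: quotient_lower_bound v V tk eventually_True ereal_less_eq(1))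
next
  case False
  then have "\<forall>\<^sub>F k in sequentially. (\<lambda>x. u x + t k * V k x) \<notin> U_ad M \<alpha> \<beta>"
    using weak_limit_feasible_tangent[OF assms(2,3)] by (auto simp: frequently_def)
  then have "\<forall>\<^sub>F k in sequentially. quotient (t k) (V k) = \<infinity>"
    by eventually_elim
       (use assms(2) u_ad in \<open>simp add: second_quotient_G1 decr_to_zero_def\<close>)
  then show ?thesis by (rule tendsto_eventually)
qed

section \<open>The weak second subderivative and strong twice epi-differentiability\<close>

lemma weak_second_subderivative_critical:
  assumes "v \<in> critical_cone M \<alpha> \<beta> \<mu> (\<lambda>x. - w x) u"
  shows "weak_second_subderivative M (G1 M \<alpha> \<beta> \<mu>) u w v = 0"
proof (rule antisym)
  \<comment> \<open>Some null sequence is needed so that the recovery sequence enters the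
    infimum.\<close>
  have "decr_to_zero (\<lambda>n. 1 / real (Suc n))"
    unfolding decr_to_zero_def using lim_inverse_n' LIMSEQ_Suc by fastforce
  then obtain t where t: "decr_to_zero t" by blast
  from critical_recovery_sequence[OF assms t] obtain V
    where V: "L2_strong_conv M V v" "\<forall>k. quotient (t k) (V k) = 0" by blast
  have "liminf (\<lambda>k. quotient (t k) (V k)) = 0"
    using V(2) by (simp add: Liminf_const)
  with t L2_strong_imp_weak[OF V(1)]
  show "weak_second_subderivative M (G1 M \<alpha> \<beta> \<mu>) u w v \<le> 0"
    unfolding weak_second_subderivative_def by (intro Inf_lower) force
  show "0 \<le> weak_second_subderivative M (G1 M \<alpha> \<beta> \<mu>) u w v"
    unfolding weak_second_subderivative_def
    by (rule Inf_greatest)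
       (auto intro!: Liminf_bounded always_eventually quotient_nonneg
          simp: L2_weak_conv_def decr_to_zero_def)
qed

lemma weak_second_subderivative_noncritical:
  assumes "v \<notin> critical_cone M \<alpha> \<beta> \<mu> (\<lambda>x. - w x) u"
  shows "weak_second_subderivative M (G1 M \<alpha> \<beta> \<mu>) u w v = \<infinity>"
proof -
  have "\<infinity> \<le> weak_second_subderivative M (G1 M \<alpha> \<beta> \<mu>) u w v"
    unfolding weak_second_subderivative_def
  proof (rule Inf_greatest, clarify)
    fix t V assume "decr_to_zero t" "L2_weak_conv M V v"
    from lim_imp_Liminf[OF trivial_limit_sequentially noncritical_quotient_tendsto[OF assms this]]
    show "\<infinity> \<le> liminf (\<lambda>k. quotient (t k) (V k))"
      by (rule eq_refl[OF sym])
  qed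
  then show ?thesis by simp
qed

text \<open>On the critical cone the recovery sequence attains the value 0. Elsewhere the
  subderivative is \<infinity> and every weakly convergent sequence reaches it, so the constant
  sequence \<open>v\<close> will do.\<close>

lemma G1_strongly_twice_epi_differentiable:
  "strongly_twice_epi_differentiable M (G1 M \<alpha> \<beta> \<mu>) u w"
  unfolding strongly_twice_epi_differentiable_def
proof (intro ballI allI impI)
  fix v t assume v: "v \<in> L2 M" and t: "decr_to_zero t"
  show "\<exists>V. L2_strong_conv M V v \<and>
      (\<lambda>k. quotient (t k) (V k)) \<longlonglongrightarrow> weak_second_subderivative M (G1 M \<alpha> \<beta> \<mu>) u w v"
  proof (cases "v \<in> critical_cone M \<alpha> \<beta> \<mu> (\<lambda>x. - w x) u")
    case True
    from critical_recovery_sequence[OF True t] obtain V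
      where "L2_strong_conv M V v" "\<forall>k. quotient (t k) (V k) = 0" by blast
    then show ?thesis
      by (intro exI[of _ V]) (simp add: weak_second_subderivative_critical[OF True])
  next
    case False
    with noncritical_quotient_tendsto[OF False t L2_strong_imp_weak] L2_strong_conv_const[OF v]
    show ?thesis
      by (intro exI[of _ "\<lambda>k. v"]) (simp add: weak_second_subderivative_noncritical[OF False])
  qed
qed

end

section \<open>Specialization to the space-time cylinder\<close>

theorem theorem3p6:
  fixes \<Omega> :: "(real ^ 'd) set"
    and T \<alpha> \<beta> \<mu> :: real
    and ubar dF :: "(real ^ 'd) \<times> real \<Rightarrow> real"
    and F :: "((real ^ 'd) \<times> real \<Rightarrow> real) \<Rightarrow> real"
    and ddF :: "((real ^ 'd) \<times> real \<Rightarrow> real) \<Rightarrow> ((real ^ 'd) \<times> real \<Rightarrow> real) \<Rightarrow> real"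
  assumes "\<Omega> \<noteq> {}" and "open \<Omega>" and "bounded \<Omega>"
    and "T > 0" and "\<alpha> < \<beta>" and "\<mu> > 0"
    and "ubar \<in> U_ad (cylinder \<Omega> T) \<alpha> \<beta>"
    and F_well_defined: "\<And>u u'. u \<in> U_ad (cylinder \<Omega> T) \<alpha> \<beta> \<Longrightarrow> u' \<in> U_ad (cylinder \<Omega> T) \<alpha> \<beta> \<Longrightarrow>
          (AE x in cylinder \<Omega> T. u x = u' x) \<Longrightarrow> F u = F u'"
    and "dF \<in> L2 (cylinder \<Omega> T)"
    and "bounded_bilinear_form_L2 (cylinder \<Omega> T) ddF"
    and F_expansion: "\<And>t V v. decr_to_zero t \<Longrightarrow> L2_weak_conv (cylinder \<Omega> T) V v \<Longrightarrow>
          (\<And>k. (\<lambda>x. ubar x + t k * V k x) \<in> U_ad (cylinder \<Omega> T) \<alpha> \<beta>) \<Longrightarrow>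
          (\<lambda>k. (F (\<lambda>x. ubar x + t k * V k x) - F ubar
                  - t k * L2_inner (cylinder \<Omega> T) dF (V k)
                  - (1/2) * (t k)\<^sup>2 * ddF (V k) (V k)) / (t k)\<^sup>2) \<longlonglongrightarrow> 0"
    and "(\<lambda>x. - dF x) \<in> L2_subdifferential (cylinder \<Omega> T) (G1 (cylinder \<Omega> T) \<alpha> \<beta> \<mu>) ubar"
  shows "(\<forall>v \<in> critical_cone (cylinder \<Omega> T) \<alpha> \<beta> \<mu> dF ubar.
            weak_second_subderivative (cylinder \<Omega> T) (G1 (cylinder \<Omega> T) \<alpha> \<beta> \<mu>) ubar (\<lambda>x. - dF x) v = 0)
       \<and> strongly_twice_epi_differentiable (cylinder \<Omega> T) (G1 (cylinder \<Omega> T) \<alpha> \<beta> \<mu>) ubar (\<lambda>x. - dF x)"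
proof -
  \<comment> \<open>A bounded open set has finite Lebesgue measure, which gives the finite measure
    required by the locale.\<close>
  have "bounded (\<Omega> \<times> {0<..<T})"
    using \<open>bounded \<Omega>\<close> by (intro bounded_Times) auto
  moreover have "open (\<Omega> \<times> {0<..<T})"
    using \<open>open \<Omega>\<close> by (intro open_Times) auto
  ultimately have "finite_measure (cylinder \<Omega> T)"
    by (intro finite_measure_lebesgue_on lmeasurable_open)
  then interpret finite_measure "cylinder \<Omega> T" .
  interpret G1_subgradient "cylinder \<Omega> T" \<alpha> \<beta> \<mu> ubar "\<lambda>x. - dF x"
    by unfold_locales fact+
  show ?thesis
    using weak_second_subderivative_critical G1_strongly_twice_epi_differentiable
    \<comment> \<open>The locale states the critical cone with \<open>- w x\<close>; for
      \<open>w = (\<lambda>x. - dF x)\<close> the double negation collapses to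
      \<open>dF\<close>.\<close>
    unfolding minus_minus by blast
qed

end
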